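(* For any sequence $\mathbf{s}=(s_i)_{i\ge1}$ of positive integers and any positive integer $n$, the $\mathbf{h}^*$-polynomial of the $\mathbf{s}$-lecture hall polytope $\mathscr{P}_n^{(\mathbf{s})}$ has all roots real.
   Context: The $\mathbf{s}$-lecture hall polytope is $\mathscr{P}_n^{(\mathbf{s})}=\{(\lambda_1,\dots,\lambda_n)\in\mathbb{R}^n\mid 0\le\lambda_1/s_1\le\lambda_2/s_2\le\cdots\le\lambda_n/s_n\le1\}$; it is an $n$-dimensional polytope all of whose vertices have integer coordinates. For an integral polytope $\mathscr{P}\subset\mathbb{R}^n$ of dimension $n$, let $i(\mathscr{P},t)=|t\mathscr{P}\cap\mathbb{Z}^n|$, where $t\mathscr{P}=\{t\lambda\mid\lambda\in\mathscr{P}\}$; the Ehrhart series has the form $\sum_{t\ge0}i(\mathscr{P},t)x^t=\mathbf{h}(x)/(1-x)^{n+1}$ with $\mathbf{h}(x)$ a polynomial of degree at most $n$, called the $\mathbf{h}^*$-polynomial of $\mathscr{P}$. *)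

theory Defs
  imports "HOL-Computational_Algebra.Computational_Algebra"
begin

text \<open>
  Since \<open>n\<close> varies, $\mathbb{R}^n$ is modelled by the functions \<open>nat \<Rightarrow> real\<close> vanishing outside the
  index set \<open>{1..n}\<close>, so that coordinates are numbered from 1 and every vector has exactly one
  representative (which matters for counting lattice points).
\<close>

definition real_space :: "nat \<Rightarrow> (nat \<Rightarrow> real) set" where
  "real_space n = {x. \<forall>i. i \<notin> {1..n} \<longrightarrow> x i = 0}"

definition int_lattice :: "nat \<Rightarrow> (nat \<Rightarrow> real) set" where
  "int_lattice n = {x \<in> real_space n. \<forall>i\<in>{1..n}. x i \<in> \<int>}"

definition dilate :: "nat \<Rightarrow> (nat \<Rightarrow> real) set \<Rightarrow> (nat \<Rightarrow> real) set" where
  "dilate t P = (\<lambda>x i. real t * x i) ` P"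

definition ehrhart_count :: "nat \<Rightarrow> (nat \<Rightarrow> real) set \<Rightarrow> nat \<Rightarrow> nat" where
  "ehrhart_count n P t = card (dilate t P \<inter> int_lattice n)"

definition ehrhart_series :: "nat \<Rightarrow> (nat \<Rightarrow> real) set \<Rightarrow> real fps" where
  "ehrhart_series n P = Abs_fps (\<lambda>t. of_nat (ehrhart_count n P t))"

definition is_hstar_poly :: "nat \<Rightarrow> (nat \<Rightarrow> real) set \<Rightarrow> real poly \<Rightarrow> bool" where
  "is_hstar_poly n P h \<longleftrightarrow>
     degree h \<le> n \<and> ehrhart_series n P = fps_of_poly h / (1 - fps_X) ^ (n + 1)"

text \<open>
  Meaningful for integral polytopes of dimension \<open>n\<close> in $\mathbb{R}^n$, where such a polynomial
  exists; it is unique whenever it exists, as shown below.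
\<close>

definition hstar_poly :: "nat \<Rightarrow> (nat \<Rightarrow> real) set \<Rightarrow> real poly" where
  "hstar_poly n P = (THE h. is_hstar_poly n P h)"

lemma is_hstar_poly_unique:
  assumes "is_hstar_poly n P h" and "is_hstar_poly n P h'"
  shows "h = h'"
proof -
  have unit: "is_unit ((1 - fps_X :: real fps) ^ (n + 1))"
    by (subst fps_is_unit_iff) (simp add: fps_nth_power_0)
  have "fps_of_poly h / (1 - fps_X) ^ (n + 1) = fps_of_poly h' / (1 - fps_X) ^ (n + 1)"
    using assms by (simp add: is_hstar_poly_def)
  then have "fps_of_poly h = fps_of_poly h'"
    using unit by (metis dvd_div_mult_self unit_imp_dvd)
  then show ?thesis
    by (simp add: fps_of_poly_eq_iff)
qed

lemma hstar_poly_eqI: "is_hstar_poly n P h \<Longrightarrow> hstar_poly n P = h"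
  unfolding hstar_poly_def by (rule the_equality) (auto intro: is_hstar_poly_unique)

text \<open>The value \<open>s 0\<close> is never used.\<close>

definition lecture_hall_polytope :: "(nat \<Rightarrow> nat) \<Rightarrow> nat \<Rightarrow> (nat \<Rightarrow> real) set" where
  "lecture_hall_polytope s n =
     {x \<in> real_space n.
        0 \<le> x 1 / real (s 1) \<and>
        (\<forall>i\<in>{1..<n}. x i / real (s i) \<le> x (i + 1) / real (s (i + 1))) \<and>
        x n / real (s n) \<le> 1}"

definition all_roots_real :: "real poly \<Rightarrow> bool" where
  "all_roots_real p \<longleftrightarrow> (\<forall>z::complex. poly (map_poly of_real p) z = 0 \<longrightarrow> z \<in> \<real>)"

end

theory Submission
  imports Defs
begin

text \<open>
  Write the last entry of a lecture hall sequence of length \<open>n\<close> as \<open>q * s n + r\<close> with \<open>r < s n\<close>. For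
  fixed \<open>r\<close>, the generating function in \<open>q\<close> is \<open>P n r / (1 - x) ^ n\<close>, where \<open>P (n + 1) r\<close> is the
  sum of the \<open>P n j\<close> with \<open>j / s n \<le> r / s (n + 1)\<close> plus \<open>x\<close> times the sum of the remaining ones;
  the polynomial of the polytope is the case where one further entry \<open>t\<close> with \<open>s (n + 1) = 1\<close> is
  appended.

  Fix \<open>z\<close> in the open upper half plane. The numbers \<open>P n (s n - 1)\<close>, ..., \<open>P n 0\<close>,
  \<open>z * P n (s n - 1)\<close>, ..., \<open>z * P n 0\<close>, evaluated at \<open>z\<close>, are nonzero and have weakly increasing
  arguments. As a set of inequalities between imaginary parts of products this is bilinear, so it is
  inherited by the sums defining \<open>P (n + 1)\<close>, and no \<open>P n r\<close> vanishes at \<open>z\<close>.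
\<close>

section \<open>Real-rootedness\<close>

text \<open>For nonzero \<open>a\<close> and \<open>b\<close>, \<open>0 <= Im (a * cnj b)\<close>
  puts \<open>a\<close> at most a half turn counterclockwise from \<open>b\<close>. The inequalities
  order any two entries at most \<open>m\<close> places apart in the list \<open>w (m - 1)\<close>,
  ..., \<open>w 0\<close>, \<open>z * w (m - 1)\<close>, ..., \<open>z * w 0\<close>; pairs with two
  factors \<open>z\<close> follow by scaling. Nonvanishing is a separate clause because zero
  satisfies all the inequalities.\<close>

definition interlaced :: "complex \<Rightarrow> nat \<Rightarrow> (nat \<Rightarrow> complex) \<Rightarrow> bool" where
  "interlaced z m w \<longleftrightarrow> (\<forall>i<m. w i \<noteq> 0) \<and>
     (\<forall>i j. i \<le> j \<longrightarrow> j < m \<longrightarrow> 0 \<le> Im (w i * cnj (w j)) \<and> 0 \<le> Im (z * w j * cnj (w i)))"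

text \<open>For \<open>c <= m\<close> this sums \<open>m\<close> consecutive entries of that list:
  \<open>w (c - 1)\<close>, ..., \<open>w 0\<close>, \<open>z * w (m - 1)\<close>, ...,
  \<open>z * w c\<close>. A larger \<open>c\<close> moves the window towards the start of the
  list.\<close>

definition twisted_sum :: "complex \<Rightarrow> nat \<Rightarrow> (nat \<Rightarrow> complex) \<Rightarrow> nat \<Rightarrow> complex" where
  "twisted_sum z m w c = sum w {..<c} + z * sum w {c..<m}"

lemma Im_sum_mult_cnj_nonneg:
  assumes "\<And>i j. i \<in> A \<Longrightarrow> j \<in> B \<Longrightarrow> 0 \<le> Im (f i * cnj (g j))"
  shows "0 \<le> Im (sum f A * cnj (sum g B))"
proof -
  have "sum f A * cnj (sum g B) = (\<Sum>i\<in>A. \<Sum>j\<in>B. f i * cnj (g j))"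
    by (simp add: sum_product)
  then show ?thesis
    using assms by (auto intro!: sum_nonneg)
qed

lemma Im_mult_cnj_scale: "Im (z * a * cnj (z * b)) = (cmod z)\<^sup>2 * Im (a * cnj b)"
  by (simp add: cmod_power2) (simp add: power2_eq_square algebra_simps)

lemma Im_mult_self_cnj: "Im (z * u * cnj u) = (cmod u)\<^sup>2 * Im z"
  by (simp add: cmod_power2) (simp add: power2_eq_square algebra_simps)

text \<open>All summands lie in the cone spanned by the first one, \<open>v = w (c - 1)\<close>, and
  \<open>z * v\<close>. It is narrower than a half turn because \<open>Im z > 0\<close>, so the
  summands cannot cancel \<open>v\<close>.\<close>

lemma twisted_sum_nonzero:
  assumes w: "interlaced z m w" and z: "Im z > 0" and c: "0 < c" "c \<le> m"
  shows "twisted_sum z m w c \<noteq> 0"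
proof -
  define v where "v = w (c - 1)"
  have v: "v \<noteq> 0"
    using w c by (auto simp: interlaced_def v_def)
  text \<open>In the basis \<open>v\<close>, \<open>z * v\<close> of the plane, \<open>L u\<close> is a positive multiple of the sum of the
    coordinates of \<open>u\<close>.\<close>
  define L where "L u = Im (u * cnj v) + Im (z * v * cnj u)" for u
  have L_add: "L (a + b) = L a + L b" for a b
    by (simp add: L_def algebra_simps)
  have L_sum: "L (sum f A) = (\<Sum>i\<in>A. L (f i))" for f and A :: "nat set"
    by (simp add: L_def sum_distrib_left sum_distrib_right sum.distrib)
  have low: "L (w i) \<ge> 0" if "i < c" for i
    using w that c by (simp add: L_def v_def interlaced_def)
  have high: "L (z * w j) \<ge> 0" if "j \<in> {c..<m}" for j
  proof -
    have "0 \<le> Im (v * cnj (w j))" "0 \<le> Im (z * w j * cnj v)"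
      using w that c unfolding interlaced_def v_def by auto
    then show ?thesis
      unfolding L_def Im_mult_cnj_scale by simp
  qed
  have "L v = (cmod v)\<^sup>2 * Im z"
    unfolding L_def Im_mult_self_cnj by simp
  then have "0 < L v"
    using v z by simp
  also have "L v \<le> (\<Sum>i<c. L (w i))"
    using member_le_sum[of "c - 1" "{..<c}" "\<lambda>i. L (w i)"] low c by (auto simp: v_def)
  also have "\<dots> \<le> (\<Sum>i<c. L (w i)) + (\<Sum>j=c..<m. L (z * w j))"
    using sum_nonneg[of "{c..<m}" "\<lambda>j. L (z * w j)"] high by simp
  also have "\<dots> = L (twisted_sum z m w c)"
    by (simp add: twisted_sum_def L_add L_sum sum_distrib_left)
  finally show ?thesis
    by (auto simp: L_def)
qed

lemma twisted_sum_pair: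
  assumes w: "interlaced z m w" and z: "Im z > 0" and cd: "c \<le> d" "d \<le> m"
  shows "0 \<le> Im (twisted_sum z m w c * cnj (twisted_sum z m w d))"
    and "0 \<le> Im (z * twisted_sum z m w d * cnj (twisted_sum z m w c))"
proof -
  \<comment> \<open>With \<open>P = A + z * B\<close> the two windows are \<open>P + z * W\<close>
    and \<open>P + W\<close>. Expanding leaves only comparisons of \<open>W\<close> with
    \<open>A\<close> and with \<open>B\<close>, and products of a number with its own conjugate,
    possibly times \<open>z\<close>.\<close>
  define A W B where "A = sum w {..<c}" and "W = sum w {c..<d}" and "B = sum w {d..<m}"
  have c_eq: "twisted_sum z m w c = A + z * W + z * B"
    using sum.atLeastLessThan_concat[OF cd, of w]
    by (simp add: twisted_sum_def A_def W_def B_def flip: distrib_left add.assoc)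
  have d_eq: "twisted_sum z m w d = A + W + z * B"
    using sum.atLeastLessThan_concat[of 0 c d w] cd
    by (simp add: twisted_sum_def A_def W_def B_def atLeast0LessThan)
  have up: "0 \<le> Im (w i * cnj (w j))" "0 \<le> Im (z * w j * cnj (w i))"
    if "i \<le> j" "j < m" for i j
    using w that by (auto simp: interlaced_def)
  have AW: "0 \<le> Im (A * cnj W)" and WB: "0 \<le> Im (W * cnj B)"
    unfolding A_def W_def B_def using cd by (intro Im_sum_mult_cnj_nonneg up; simp)+
  have zWA: "0 \<le> Im (z * W * cnj A)" and zBW: "0 \<le> Im (z * B * cnj W)"
    unfolding A_def W_def B_def sum_distrib_left using cd
    by (intro Im_sum_mult_cnj_nonneg up; simp)+
  have self': "0 \<le> Im (z * u * cnj u)" for u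
    unfolding Im_mult_self_cnj using z by simp
  have split: "Im (twisted_sum z m w c * cnj (twisted_sum z m w d)) =
      Im (z * W * cnj A) + Im (A * cnj W) + Im (z * W * cnj W) + Im (z * B * cnj W)
      + (cmod z)\<^sup>2 * Im (W * cnj B)"
    unfolding c_eq d_eq Im_mult_cnj_scale[symmetric] by (simp add: algebra_simps)
  show "0 \<le> Im (twisted_sum z m w c * cnj (twisted_sum z m w d))"
    unfolding split
    by (intro add_nonneg_nonneg mult_nonneg_nonneg zero_le_power2 AW WB zWA zBW self')
  have split': "Im (z * twisted_sum z m w d * cnj (twisted_sum z m w c)) =
      Im (z * (A + z * B) * cnj (A + z * B)) + Im (z * W * cnj A)
      + (cmod z)\<^sup>2 * (Im (A * cnj W) + Im (W * cnj B) + Im (z * B * cnj W))"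
    unfolding c_eq d_eq distrib_left[of "(cmod z)\<^sup>2"] Im_mult_cnj_scale[symmetric]
    by (simp add: algebra_simps)
  show "0 \<le> Im (z * twisted_sum z m w d * cnj (twisted_sum z m w c))"
    unfolding split'
    by (intro add_nonneg_nonneg mult_nonneg_nonneg zero_le_power2 AW WB zWA zBW self')
qed

lemma interlaced_twisted_sums:
  assumes "interlaced z m w" "Im z > 0"
    and "\<And>i. i < k \<Longrightarrow> 0 < c i" "\<And>i. i < k \<Longrightarrow> c i \<le> m"
    and "\<And>i j. i \<le> j \<Longrightarrow> j < k \<Longrightarrow> c i \<le> c j"
  shows "interlaced z k (\<lambda>i. twisted_sum z m w (c i))"
  unfolding interlaced_def[of z k]
proof (intro conjI allI impI)
  show "twisted_sum z m w (c i) \<noteq> 0" if "i < k" for i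
    using assms that by (simp add: twisted_sum_nonzero)
qed (use assms in \<open>simp_all only: twisted_sum_pair le_less_trans\<close>)

text \<open>For residues \<open>j\<close> and \<open>r\<close>, the entry \<open>p * s n + j\<close>
  may precede \<open>q * s (Suc n) + r\<close> iff \<open>p <= q\<close> if
  \<open>j / s n <= r / s (Suc n)\<close>, and iff \<open>p < q\<close> otherwise. The strict bound
  shifts the series, whence the factor \<open>[:0, 1:]\<close>.\<close>

fun lecture_hall_poly :: "(nat \<Rightarrow> nat) \<Rightarrow> nat \<Rightarrow> nat \<Rightarrow> real poly" where
  "lecture_hall_poly s 0 r = 1"
| "lecture_hall_poly s (Suc n) r =
     (\<Sum>j<s n. (if j * s (Suc n) \<le> r * s n then 1 else [:0, 1:]) * lecture_hall_poly s n j)"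

text \<open>Each step raises the degree by at most one, except the first: since
  \<open>s 0 = 1\<close>, only \<open>j = 0\<close> occurs there, with factor 1.\<close>

lemma degree_lecture_hall_poly:
  assumes "s 0 = 1"
  shows "degree (lecture_hall_poly s n r) \<le> n - 1"
proof (induction n arbitrary: r)
  case (Suc n)
  show ?case
  proof (cases "n = 0")
    case True
    then show ?thesis
      using assms by (simp add: lessThan_Suc)
  next
    case False
    have "degree ((if j * s (Suc n) \<le> r * s n then 1 else [:0, 1:]) * lecture_hall_poly s n j)
        \<le> n" for j
      using degree_mult_le[of "[:0, 1:]" "lecture_hall_poly s n j"] Suc.IH[of j] False
      by (auto intro: order_trans)
    then show ?thesis
      by (simp add: degree_sum_le)
  qed
qed simp

lemma map_poly_of_real_sum: "map_poly of_real (sum f A) = (\<Sum>i\<in>A. map_poly of_real (f i))"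
  by (rule poly_eqI) (simp add: coeff_map_poly coeff_sum)

lemma map_poly_of_real_mult: "map_poly of_real (p * q) = map_poly of_real p * map_poly of_real q"
  by (rule poly_eqI) (simp add: coeff_map_poly coeff_mult)

lemma interlaced_lecture_hall_poly:
  assumes s: "s 0 = 1" "\<And>i. s i > 0" and z: "Im z > 0"
  shows "interlaced z (s n) (\<lambda>r. poly (map_poly of_real (lecture_hall_poly s n r)) z)"
proof (induction n)
  case 0
  then show ?case
    using s z by (simp add: interlaced_def)
next
  case (Suc n)
  define w where "w r = poly (map_poly of_real (lecture_hall_poly s n r)) z" for r
  \<comment> \<open>The factor is 1 exactly for \<open>j <= r * s n div s (Suc n)\<close>. This
    initial segment contains \<open>j = 0\<close>, so \<open>c r\<close> is positive, as
    \<open>twisted_sum_nonzero\<close> requires. The minimum keeps \<open>c r\<close> at most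
    \<open>s n\<close> for arbitrary \<open>r\<close>.\<close>
  define c where "c r = min (s n) (Suc (r * s n div s (Suc n)))" for r
  have c_mono: "c i \<le> c j" if "i \<le> j" for i j
    unfolding c_def using that
    by (intro min.mono Suc_le_mono[THEN iffD2] div_le_mono mult_le_mono1) simp_all
  have below: "j * s (Suc n) \<le> r * s n \<longleftrightarrow> j < c r" if "j < s n" for j r
    using that s(2)[of "Suc n"] by (simp add: c_def less_Suc_eq_le less_eq_div_iff_mult_less_eq)
  have "poly (map_poly of_real (lecture_hall_poly s (Suc n) r)) z = twisted_sum z (s n) w (c r)" for r
  proof -
    have "poly (map_poly of_real (lecture_hall_poly s (Suc n) r)) z
        = (\<Sum>j<s n. (if j < c r then 1 else z) * w j)"
      by (auto simp: w_def below map_poly_of_real_sum map_poly_of_real_mult map_poly_pCons poly_sum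
          intro!: sum.cong)
    also have "\<dots> = (\<Sum>j<c r. (if j < c r then 1 else z) * w j)
        + (\<Sum>j=c r..<s n. (if j < c r then 1 else z) * w j)"
      using sum.atLeastLessThan_concat[of 0 "c r" "s n" "\<lambda>j. (if j < c r then 1 else z) * w j"]
      by (simp add: atLeast0LessThan c_def del: min_less_iff_conj)
    also have "\<dots> = twisted_sum z (s n) w (c r)"
      by (simp add: twisted_sum_def sum_distrib_left)
    finally show ?thesis .
  qed
  moreover have "interlaced z (s (Suc n)) (\<lambda>r. twisted_sum z (s n) w (c r))"
    using Suc.IH z s(2)[of n] unfolding w_def[symmetric]
    by (intro interlaced_twisted_sums c_mono) (auto simp: c_def)
  ultimately show ?case
    by simp
qed

text \<open>Roots of a real polynomial come in conjugate pairs, so a nonreal root would yield one in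
  the upper half plane.\<close>

lemma all_roots_real_if_upper_nonzero:
  assumes "\<And>z. Im z > 0 \<Longrightarrow> poly (map_poly of_real p) z \<noteq> 0"
  shows "all_roots_real p"
  unfolding all_roots_real_def
proof (intro allI impI)
  fix z :: complex
  assume root: "poly (map_poly of_real p) z = 0"
  then have "poly (map_poly of_real p) (cnj z) = 0"
    using poly_cnj_real[of "map_poly of_real p" z] by (simp add: coeff_map_poly)
  then show "z \<in> \<real>"
    using assms[of z] assms[of "cnj z"] root
    by (cases "Im z" "0 :: real" rule: linorder_cases) (auto simp: complex_is_Real_iff)
qed

section \<open>Counting lecture hall sequences\<close>

text \<open>The auxiliary entry \<open>x 0 = 0\<close> lets the recursion start at length 0.
  Vanishing beyond \<open>n\<close> makes each sequence a single function, and cross-multiplication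
  keeps the comparisons in the naturals.\<close>

definition lecture_hall_seqs :: "(nat \<Rightarrow> nat) \<Rightarrow> nat \<Rightarrow> nat \<Rightarrow> (nat \<Rightarrow> nat) set" where
  "lecture_hall_seqs s n m = {x. x 0 = 0 \<and> x n = m \<and> (\<forall>i>n. x i = 0) \<and>
     (\<forall>i<n. x i * s (Suc i) \<le> x (Suc i) * s i)}"

lemma lecture_hall_seqs_0: "lecture_hall_seqs s 0 m = (if m = 0 then {\<lambda>_. 0} else {})"
proof -
  have "x 0 = 0 \<and> (\<forall>i>0. x i = 0) \<longleftrightarrow> x = (\<lambda>_. 0)" for x :: "nat \<Rightarrow> nat"
    by (metis bot_nat_0.not_eq_extremum)
  then show ?thesis
    by (auto simp: lecture_hall_seqs_def)
qed

lemma lecture_hall_seqs_Suc: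
  "lecture_hall_seqs s (Suc n) m =
     (\<Union>k\<in>{k. k * s (Suc n) \<le> m * s n}. (\<lambda>x. x(Suc n := m)) ` lecture_hall_seqs s n k)"
    (is "?L = ?R")
proof
  show "?L \<subseteq> ?R"
  proof
    fix x assume x: "x \<in> ?L"
    then have "x(Suc n := 0) \<in> lecture_hall_seqs s n (x n)" "x n * s (Suc n) \<le> m * s n"
      by (auto simp: lecture_hall_seqs_def)
    moreover have "x = (x(Suc n := 0))(Suc n := m)"
      using x by (auto simp: lecture_hall_seqs_def)
    ultimately show "x \<in> ?R"
      by blast
  qed
  show "?R \<subseteq> ?L"
    by (auto simp: lecture_hall_seqs_def less_Suc_eq)
qed

lemma finite_mult_le:
  fixes a b :: nat
  assumes "a > 0"
  shows "finite {k. k * a \<le> b}"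
proof -
  have "{k. k * a \<le> b} = {..b div a}"
    using assms by (auto simp: less_eq_div_iff_mult_less_eq)
  then show ?thesis
    by simp
qed

lemma finite_lecture_hall_seqs:
  assumes "\<And>i. s i > 0"
  shows "finite (lecture_hall_seqs s n m)"
proof (induction n arbitrary: m)
  case 0
  then show ?case
    by (simp add: lecture_hall_seqs_0)
next
  case (Suc n)
  then show ?case
    unfolding lecture_hall_seqs_Suc by (intro finite_UN_I finite_imageI finite_mult_le assms)
qed

text \<open>The union over \<open>k\<close> is disjoint because entry \<open>n\<close> still records
  \<open>k\<close> after the new entry is appended.\<close>

lemma card_lecture_hall_seqs_Suc:
  assumes "\<And>i. s i > 0"
  shows "card (lecture_hall_seqs s (Suc n) m) =
     (\<Sum>k | k * s (Suc n) \<le> m * s n. card (lecture_hall_seqs s n k))"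
proof -
  have restore: "(x(Suc n := m))(Suc n := 0) = x" if "x \<in> lecture_hall_seqs s n k" for x k
    using that by (auto simp: lecture_hall_seqs_def)
  have inj: "inj_on (\<lambda>x. x(Suc n := m)) (lecture_hall_seqs s n k)" for k
    by (rule inj_on_inverseI[where g = "\<lambda>x. x(Suc n := 0)"]) (rule restore)
  have "(\<lambda>x. x(Suc n := m)) ` lecture_hall_seqs s n k \<inter>
      (\<lambda>x. x(Suc n := m)) ` lecture_hall_seqs s n l = {}" if "k \<noteq> l" for k l
  proof -
    have "y n = k" if "y \<in> (\<lambda>x. x(Suc n := m)) ` lecture_hall_seqs s n k" for y k
      using that by (auto simp: lecture_hall_seqs_def)
    then show ?thesis
      using that by blast
  qed
  then show ?thesis
    unfolding lecture_hall_seqs_Suc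
    by (subst card_UN_disjoint)
      (auto simp: finite_mult_le finite_lecture_hall_seqs assms card_image inj)
qed

text \<open>Put \<open>k = p * a + j\<close> with \<open>j < a\<close>. The condition compares
  \<open>p + j / a\<close> with \<open>q + r / b\<close>, where the fractional parts matter only if
  \<open>p = q\<close>.\<close>

lemma sum_mult_le_div_mod:
  fixes a b q r :: nat and g :: "nat \<Rightarrow> 'a::comm_monoid_add"
  assumes r: "r < b" and a: "a > 0"
  shows "(\<Sum>k | k * b \<le> (q * b + r) * a. g k) =
    (\<Sum>j<a. \<Sum>p<(if j * b \<le> r * a then Suc q else q). g (p * a + j))"
proof -
  define N where "N j = (if j * b \<le> r * a then Suc q else q)" for j
  have iff: "(p * a + j) * b \<le> (q * b + r) * a \<longleftrightarrow> p < N j" if j: "j < a" for p j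
  proof -
    have jb: "j * b < a * b" and ra: "r * a < a * b"
      using j r a by auto
    have expand: "(p * a + j) * b = p * (a * b) + j * b" "(q * b + r) * a = q * (a * b) + r * a"
      by (simp_all add: algebra_simps)
    consider "p < q" | "p = q" | "p > q" by linarith
    then show ?thesis
    proof cases
      case 1
      then have "Suc p * (a * b) \<le> q * (a * b)"
        by (intro mult_le_mono1) simp
      then have "p * (a * b) + j * b \<le> q * (a * b) + r * a"
        using jb unfolding mult_Suc by linarith
      then show ?thesis
        using 1 unfolding expand N_def by simp
    next
      case 2
      then show ?thesis
        by (simp add: N_def algebra_simps)
    next
      case 3
      then have "Suc q * (a * b) \<le> p * (a * b)"
        by (intro mult_le_mono1) simp
      then have "\<not> p * (a * b) + j * b \<le> q * (a * b) + r * a"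
        using ra unfolding mult_Suc by linarith
      then show ?thesis
        using 3 unfolding expand N_def by simp
    qed
  qed
  have "(\<Sum>k | k * b \<le> (q * b + r) * a. g k) = (\<Sum>(j, p)\<in>(SIGMA j:{..<a}. {..<N j}). g (p * a + j))"
  proof (rule sum.reindex_bij_witness[where i = "\<lambda>(j, p). p * a + j" and j = "\<lambda>k. (k mod a, k div a)"])
    fix k assume "k \<in> {k. k * b \<le> (q * b + r) * a}"
    then show "(k mod a, k div a) \<in> (SIGMA j:{..<a}. {..<N j})"
      using iff[of "k mod a" "k div a"] a by simp
  qed (use iff a in \<open>auto simp: N_def\<close>)
  also have "\<dots> = (\<Sum>j<a. \<Sum>p<N j. g (p * a + j))"
    by (rule sum.Sigma[symmetric]) auto
  finally show ?thesis
    by (simp add: N_def)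
qed

section \<open>Generating functions for a fixed residue of the last entry\<close>

definition lecture_hall_fps :: "(nat \<Rightarrow> nat) \<Rightarrow> nat \<Rightarrow> nat \<Rightarrow> real fps" where
  "lecture_hall_fps s n r = Abs_fps (\<lambda>q. real (card (lecture_hall_seqs s n (q * s n + r))))"

lemma fps_mult_one_minus_X_partial_sums:
  fixes a :: "nat \<Rightarrow> 'a::comm_ring_1"
  shows "(1 - fps_X) * Abs_fps (\<lambda>q. \<Sum>p<Suc q. a p) = Abs_fps a"
proof (rule fps_ext)
  show "((1 - fps_X) * Abs_fps (\<lambda>q. \<Sum>p<Suc q. a p)) $ n = Abs_fps a $ n" for n
    by (cases n) (simp_all add: left_diff_distrib)
qed

lemma lecture_hall_fps_Suc:
  assumes s: "\<And>i. s i > 0" and r: "r < s (Suc n)"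
  shows "(1 - fps_X) * lecture_hall_fps s (Suc n) r =
    (\<Sum>j<s n. (if j * s (Suc n) \<le> r * s n then 1 else fps_X) * lecture_hall_fps s n j)"
proof -
  \<comment> \<open>Coefficient \<open>q\<close> of \<open>T j\<close> sums over
    \<open>p <= q\<close>, that of \<open>fps_X * T j\<close> over \<open>p < q\<close>: the two
    ranges in \<open>sum_mult_le_div_mod\<close>.\<close>
  define T where "T j = Abs_fps (\<lambda>q. \<Sum>p<Suc q. lecture_hall_fps s n j $ p)" for j
  have T: "(1 - fps_X) * T j = lecture_hall_fps s n j" for j
    unfolding T_def fps_mult_one_minus_X_partial_sums by (rule fps_ext) simp
  have "lecture_hall_fps s (Suc n) r =
      (\<Sum>j<s n. (if j * s (Suc n) \<le> r * s n then 1 else fps_X) * T j)" (is "_ = ?R")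
  proof (rule fps_ext)
    fix q
    have "?R $ q = (\<Sum>j<s n. ((if j * s (Suc n) \<le> r * s n then 1 else fps_X) * T j) $ q)"
      by (rule fps_sum_nth)
    also have "\<dots> = (\<Sum>j<s n. \<Sum>p<(if j * s (Suc n) \<le> r * s n then Suc q else q).
        lecture_hall_fps s n j $ p)"
      by (rule sum.cong) (auto simp: T_def simp del: sum.lessThan_Suc)
    finally show "lecture_hall_fps s (Suc n) r $ q = ?R $ q"
      using sum_mult_le_div_mod[OF r s[of n], of "\<lambda>k. real (card (lecture_hall_seqs s n k))" q]
      by (simp add: lecture_hall_fps_def card_lecture_hall_seqs_Suc s del: sum.lessThan_Suc)
  qed
  then show ?thesis
    by (simp only: sum_distrib_left mult.left_commute[of "1 - fps_X"] T)
qed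

lemma lecture_hall_fps_eq:
  assumes s: "s 0 = 1" "\<And>i. s i > 0" and r: "r < s n"
  shows "(1 - fps_X) ^ n * lecture_hall_fps s n r = fps_of_poly (lecture_hall_poly s n r)"
  using r
proof (induction n arbitrary: r)
  \<comment> \<open>As \<open>s 0 = 1\<close>, the only residue is 0, and only \<open>q = 0\<close>
    contributes, so the series is 1.\<close>
  case 0
  then show ?case
    using s by (intro fps_ext) (simp add: lecture_hall_fps_def lecture_hall_seqs_0)
next
  case (Suc n)
  have "(1 - fps_X) ^ Suc n * lecture_hall_fps s (Suc n) r
      = (1 - fps_X) ^ n * ((1 - fps_X) * lecture_hall_fps s (Suc n) r)"
    by (simp add: mult_ac)
  also have "\<dots> = (\<Sum>j<s n. (if j * s (Suc n) \<le> r * s n then 1 else fps_X) *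
      fps_of_poly (lecture_hall_poly s n j))"
    unfolding lecture_hall_fps_Suc[of s r n, OF s(2) Suc.prems] sum_distrib_left
      mult.left_commute[of "(1 - fps_X) ^ n"]
    by (intro sum.cong) (simp_all add: Suc.IH)
  also have "\<dots> = fps_of_poly (lecture_hall_poly s (Suc n) r)"
    by (auto simp: fps_of_poly_sum fps_of_poly_mult fps_of_poly_pCons intro!: sum.cong)
  finally show ?case .
qed

section \<open>Lattice points of the lecture hall polytope\<close>

lemma mono_chain:
  fixes f :: "nat \<Rightarrow> real"
  assumes "\<forall>i\<in>{1..<n}. f i \<le> f (i + 1)" and "i \<le> j" "1 \<le> i" "j \<le> n"
  shows "f i \<le> f j"
  using assms(2,4)
proof (induction j rule: dec_induct)
  case (step j)
  then have "f j \<le> f (j + 1)"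
    using assms(1,3) by simp
  then show ?case
    using step by simp
qed simp

lemma dilate_lecture_hall_polytope:
  assumes s: "\<forall>i\<ge>1. s i > 0" and n: "n > 0"
  shows "dilate t (lecture_hall_polytope s n) =
    {x \<in> real_space n. 0 \<le> x 1 / real (s 1) \<and>
      (\<forall>i\<in>{1..<n}. x i / real (s i) \<le> x (i + 1) / real (s (i + 1))) \<and>
      x n / real (s n) \<le> real t}" (is "_ = ?R")
proof
  show "dilate t (lecture_hall_polytope s n) \<subseteq> ?R"
  proof
    fix y assume "y \<in> dilate t (lecture_hall_polytope s n)"
    then obtain x where x: "x \<in> lecture_hall_polytope s n" and y: "y = (\<lambda>i. real t * x i)"
      by (auto simp: dilate_def)
    have scale: "y i / real (s i) = real t * (x i / real (s i))" for i
      by (simp add: y)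
    have "y \<in> real_space n"
      using x by (simp add: lecture_hall_polytope_def real_space_def y)
    moreover have "real t * (x n / real (s n)) \<le> real t * 1"
      using x by (intro mult_left_mono) (auto simp: lecture_hall_polytope_def)
    moreover have "0 \<le> real t * (x 1 / real (s 1))"
      using x by (intro mult_nonneg_nonneg) (auto simp: lecture_hall_polytope_def)
    moreover have "real t * (x i / real (s i)) \<le> real t * (x (i + 1) / real (s (i + 1)))"
      if "i \<in> {1..<n}" for i
      using x that by (intro mult_left_mono) (auto simp: lecture_hall_polytope_def)
    ultimately show "y \<in> ?R"
      unfolding mem_Collect_eq scale by simp
  qed
  show "?R \<subseteq> dilate t (lecture_hall_polytope s n)"
  proof
    fix y assume y: "y \<in> ?R"
    \<comment> \<open>For \<open>t = 0\<close> this is the zero vector by the convention on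
      division, and \<open>y = 0\<close> follows because the chain of ratios is squeezed between 0
      and 0.\<close>
    define x where "x = (\<lambda>i. y i / real t)"
    have scale: "x i / real (s i) = (y i / real (s i)) / real t" for i
      by (simp add: x_def)
    have "y i = real t * x i" for i
    proof (cases "t = 0")
      case True
      have "y i = 0" if i: "i \<in> {1..n}"
      proof -
        have "y 1 / real (s 1) \<le> y i / real (s i)" "y i / real (s i) \<le> y n / real (s n)"
          using y i by (intro mono_chain[of n "\<lambda>i. y i / real (s i)"]; auto)+
        moreover have "0 \<le> y 1 / real (s 1)" "y n / real (s n) \<le> 0"
          using y True by simp_all
        ultimately have "y i / real (s i) = 0"
          by linarith
        then show ?thesis
          using s[rule_format, of i] i by simp
      qed
      then show ?thesis
        using y True by (auto simp: real_space_def x_def)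
    qed (simp add: x_def)
    then have "y = (\<lambda>i. real t * x i)"
      by blast
    moreover have "x \<in> lecture_hall_polytope s n"
    proof -
      have "x \<in> real_space n"
        using y by (simp add: real_space_def x_def)
      moreover have "0 \<le> y 1 / real (s 1) / real t"
        by (rule divide_nonneg_nonneg) (use y in auto)
      moreover have "y i / real (s i) / real t \<le> y (i + 1) / real (s (i + 1)) / real t"
        if "i \<in> {1..<n}" for i
        by (rule divide_right_mono) (use y that in auto)
      \<comment> \<open>The quotient \<open>real t / real t\<close> is 1 or, for
        \<open>t = 0\<close>, 0; both are at most 1.\<close>
      moreover have "y n / real (s n) / real t \<le> real t / real t"
        by (rule divide_right_mono) (use y in auto)
      then have "y n / real (s n) / real t \<le> 1"
        by (rule order_trans) simp
      ultimately show ?thesis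
        unfolding lecture_hall_polytope_def scale mem_Collect_eq by blast
    qed
    ultimately show "y \<in> dilate t (lecture_hall_polytope s n)"
      by (auto simp: dilate_def)
  qed
qed

lemma of_nat_divide_le_iff:
  assumes "a > 0" "b > 0"
  shows "real x / real a \<le> real y / real b \<longleftrightarrow> x * b \<le> y * a"
proof -
  have "real x / real a \<le> real y / real b \<longleftrightarrow> real (x * b) \<le> real (y * a)"
    using assms by (simp add: field_simps)
  then show ?thesis
    by (simp only: of_nat_le_iff)
qed

text \<open>A point of the dilate by \<open>t\<close> is a lecture hall sequence with an additional last entry \<open>t\<close>,
  where \<open>s\<close> has been extended by \<open>1\<close>.\<close>

lemma ehrhart_count_lecture_hall:
  assumes s: "\<forall>i\<ge>1. s i > 0" and n: "n > 0"
  shows "ehrhart_count n (lecture_hall_polytope s n) t =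
    card (lecture_hall_seqs (s(0 := 1, Suc n := 1)) (Suc n) t)"
proof -
  let ?s = "s(0 := 1, Suc n := 1)"
  let ?D = "dilate t (lecture_hall_polytope s n) \<inter> int_lattice n"
  \<comment> \<open>\<open>?f\<close> drops the appended entry and \<open>?g\<close> restores it as
    \<open>t\<close>; the floor inverts \<open>real\<close> on coordinates that are nonnegative
    integers.\<close>
  let ?f = "\<lambda>x i. real ((x(Suc n := 0)) i)"
  let ?g = "\<lambda>y. (\<lambda>i. nat \<lfloor>y i\<rfloor>)(Suc n := t)"
  note D = dilate_lecture_hall_polytope[OF s n]
  have to_D: "?f x \<in> ?D" and gf: "?g (?f x) = x" if x: "x \<in> lecture_hall_seqs ?s (Suc n) t" for x
  proof -
    have step: "x i * ?s (Suc i) \<le> x (Suc i) * ?s i" if "i < Suc n" for i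
      using x that unfolding lecture_hall_seqs_def by blast
    have "real (x i) / real (s i) \<le> real (x (i + 1)) / real (s (i + 1))" if "i \<in> {1..<n}" for i
      using step[of i] that s by (subst of_nat_divide_le_iff) auto
    moreover have "real (x n) / real (s n) \<le> real t"
      using step[of n] n s[rule_format, of n] x of_nat_divide_le_iff[of "s n" 1 "x n" t]
      by (simp add: lecture_hall_seqs_def)
    ultimately show "?f x \<in> ?D"
      unfolding D using x n
      by (auto simp: real_space_def int_lattice_def lecture_hall_seqs_def Suc_le_eq not_le)
    show "?g (?f x) = x"
      using x by (auto simp: lecture_hall_seqs_def)
  qed
  have from_D: "?g y \<in> lecture_hall_seqs ?s (Suc n) t" and fg: "?f (?g y) = y" if y: "y \<in> ?D" for y
  proof -
    have out: "y i = 0" if "i \<notin> {1..n}" for i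
      using y that by (simp add: int_lattice_def real_space_def)
    have nat: "real (nat \<lfloor>y i\<rfloor>) = y i" for i
    proof (cases "i \<in> {1..n}")
      case True
      have "y 1 / real (s 1) \<le> y i / real (s i)"
        using y True unfolding D by (intro mono_chain[of n "\<lambda>i. y i / real (s i)"]) auto
      then have "0 \<le> y i / real (s i)"
        using y unfolding D by simp
      then have "0 \<le> y i"
        using s[rule_format, of i] True by (simp add: zero_le_divide_iff)
      moreover have "y i \<in> \<int>"
        using y True by (simp add: int_lattice_def)
      ultimately show ?thesis
        by (auto elim: Ints_cases)
    qed (simp add: out)
    have step: "nat \<lfloor>y i\<rfloor> * s (Suc i) \<le> nat \<lfloor>y (Suc i)\<rfloor> * s i" if "i \<in> {1..<n}" for i
      using y that s of_nat_divide_le_iff[of "s i" "s (Suc i)" "nat \<lfloor>y i\<rfloor>" "nat \<lfloor>y (Suc i)\<rfloor>"]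
      unfolding D nat by simp
    have last: "nat \<lfloor>y n\<rfloor> \<le> t * s n"
      using y n s[rule_format, of n] of_nat_divide_le_iff[of "s n" 1 "nat \<lfloor>y n\<rfloor>" t]
      unfolding D nat by simp
    have "?g y i * ?s (Suc i) \<le> ?g y (Suc i) * ?s i" if i: "i < Suc n" for i
    proof -
      \<comment> \<open>These are the comparison with the auxiliary entry 0, the inner ones, and the
        one with the appended \<open>t\<close>, which encodes the upper bound of the dilate.\<close>
      consider "i = 0" | "i \<in> {1..<n}" | "i = n"
        using i by fastforce
      then show ?thesis
        using step[of i] last n out[of 0] by cases auto
    qed
    then show "?g y \<in> lecture_hall_seqs ?s (Suc n) t"
      using out by (auto simp: lecture_hall_seqs_def)
    show "?f (?g y) = y"
      using nat out by auto
  qed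
  have "bij_betw ?f (lecture_hall_seqs ?s (Suc n) t) ?D"
    by (rule bij_betw_byWitness[where f' = ?g]) (use to_D gf from_D fg in blast)+
  then show ?thesis
    unfolding ehrhart_count_def by (simp add: bij_betw_same_card)
qed

text \<open>With 1 appended to \<open>s\<close>, the last residue is 0 and the quotient is
  \<open>t\<close>. So the series at level \<open>Suc n\<close> is the Ehrhart series, with
  denominator exponent \<open>n + 1\<close>.\<close>

lemma is_hstar_poly_lecture_hall:
  assumes s: "\<forall>i\<ge>1. s i > 0" and n: "n > 0"
  shows "is_hstar_poly n (lecture_hall_polytope s n)
    (lecture_hall_poly (s(0 := 1, Suc n := 1)) (Suc n) 0)"
proof -
  let ?s = "s(0 := 1, Suc n := 1)"
  have s': "?s 0 = 1" "?s i > 0" for i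
    using s[rule_format, of i] by auto
  have "ehrhart_series n (lecture_hall_polytope s n) = lecture_hall_fps ?s (Suc n) 0"
    unfolding ehrhart_series_def lecture_hall_fps_def ehrhart_count_lecture_hall[OF s n] by simp
  moreover have "fps_of_poly (lecture_hall_poly ?s (Suc n) 0) =
      (1 - fps_X) ^ (n + 1) * lecture_hall_fps ?s (Suc n) 0"
    using lecture_hall_fps_eq[of ?s 0 "Suc n"] s' by simp
  moreover have "degree (lecture_hall_poly ?s (Suc n) 0) \<le> n"
    using degree_lecture_hall_poly[of ?s, OF s'(1), of "Suc n" 0] unfolding diff_Suc_1 .
  moreover have "(1 - fps_X :: real fps) ^ (n + 1) \<noteq> 0"
    by (metis fps_X_neq_one power_not_zero right_minus_eq)
  ultimately show ?thesis
    by (metis is_hstar_poly_def nonzero_mult_div_cancel_left)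
qed

theorem corollary4p2:
  fixes s :: "nat \<Rightarrow> nat" and n :: nat
  assumes "\<And>i. i \<ge> 1 \<Longrightarrow> s i > 0" and "n > 0"
  shows "all_roots_real (hstar_poly n (lecture_hall_polytope s n))"
proof -
  let ?s = "s(0 := 1, Suc n := 1)"
  have s': "?s 0 = 1" "?s i > 0" for i
    using assms(1)[of i] by auto
  have "hstar_poly n (lecture_hall_polytope s n) = lecture_hall_poly ?s (Suc n) 0"
    using assms by (intro hstar_poly_eqI is_hstar_poly_lecture_hall) simp_all
  moreover have "all_roots_real (lecture_hall_poly ?s (Suc n) 0)"
  proof (rule all_roots_real_if_upper_nonzero)
    fix z :: complex
    assume "Im z > 0"
    \<comment> \<open>At level \<open>Suc n\<close> the interlaced list has the single index 0, and
      its nonvanishing clause is the claim.\<close>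
    then show "poly (map_poly of_real (lecture_hall_poly ?s (Suc n) 0)) z \<noteq> 0"
      using interlaced_lecture_hall_poly[of ?s z "Suc n", OF s'] s'(2)[of "Suc n"]
      unfolding interlaced_def by blast
  qed
  ultimately show ?thesis
    by simp
qed

end
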